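(* Let $X=\{P_1,\dots,P_r\}$ be a set of $r$ distinct points of $\mathbb P^n_{\mathbf k}$, not contained in a hyperplane, and let $L_1,\dots,L_r$ be the associated linear forms. Given an integer $u\ge1$ and $\alpha_1,\dots,\alpha_r\in\mathbf k^*$, consider the $R$-submodule $M$ of $\Gamma$ generated by the elements $$F_t:=\frac1{(t+u)!}\sum_{i=1}^r\alpha_iL_i^{t+u},\qquad t\ge1.$$ Then: (1) $M=\langle L_1^t,\dots,L_r^t;\ t\ge1\rangle$; (2) $I(X)=\operatorname{Ann}_R(M)$.
   Context: $\mathbf k$ is an algebraically closed field of characteristic zero, $n\ge1$, $R=\mathbf k[x_0,\dots,x_n]$ and $\Gamma=\mathbf k[y_0,\dots,y_n]$. $R$ acts on $\Gamma$ by differentiation: $f\circ g=f(\partial_{y_0},\dots,\partial_{y_n})(g)$, making $\Gamma$ an $R$-module. $\langle G_j\rangle$ denotes the $R$-submodule of $\Gamma$ generated by elements $G_j$; for a submodule $W$, $\operatorname{Ann}_R(W)=\{g\in R: g\circ G=0\ \forall G\in W\}$. $I(X)\subset R$ is the homogeneous ideal of $X$. The linear form associated to $P=[a_0,\dots,a_n]$ is $L=a_0y_0+\cdots+a_ny_n\in\Gamma$ (for a fixed choice of homogeneous coordinates). *)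

theory Defs
  imports
    "HOL-Analysis.Cartesian_Space"
    "HOL-Library.Poly_Mapping"
    "HOL-Computational_Algebra.Polynomial"
begin

section \<open>Polynomials and the action by differentiation\<close>

text \<open>
  The index type \<open>'n\<close> plays the role of \<open>{0, \<dots>, n}\<close>, so \<open>CARD('n) = n + 1\<close>.
  A polynomial maps an exponent vector to its coefficient.  The rings \<open>R = k[x\<^sub>0, \<dots>, x\<^sub>n]\<close> and
  \<open>\<Gamma> = k[y\<^sub>0, \<dots>, y\<^sub>n]\<close> differ only in the names of the variables and share this type.
\<close>

type_synonym ('k, 'n) mpoly = "('n \<Rightarrow>\<^sub>0 nat) \<Rightarrow>\<^sub>0 'k"

definition const_poly :: "'k::comm_ring_1 \<Rightarrow> ('k, 'n) mpoly" where
  "const_poly c = Poly_Mapping.single 0 c"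

definition var_poly :: "'n \<Rightarrow> ('k::comm_ring_1, 'n) mpoly" where
  "var_poly i = Poly_Mapping.single (Poly_Mapping.single i 1) 1"

text \<open>
  The exponent subtraction below is truncated, which is harmless: a monomial not involving
  the variable \<open>i\<close> gets the coefficient \<open>0\<close>.
\<close>

definition pdiff :: "'n \<Rightarrow> ('k::comm_ring_1, 'n) mpoly \<Rightarrow> ('k, 'n) mpoly" where
  "pdiff i g = (\<Sum>m\<in>Poly_Mapping.keys g.
     Poly_Mapping.single (m - Poly_Mapping.single i 1)
       (of_nat (poly_mapping.lookup m i) * poly_mapping.lookup g m))"

text \<open>The composition of all \<open>pdiff i ^^ m i\<close>; the order of the factors is immaterial by
  \<open>pdiff_commute\<close> below.\<close>

definition monom_diff :: "('n::finite \<Rightarrow>\<^sub>0 nat) \<Rightarrow> ('k::comm_ring_1, 'n) mpoly \<Rightarrow> ('k, 'n) mpoly" where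
  "monom_diff m g = Finite_Set.fold (\<lambda>i. pdiff i ^^ poly_mapping.lookup m i) g UNIV"

definition diff_act :: "('k::comm_ring_1, 'n::finite) mpoly \<Rightarrow> ('k, 'n) mpoly \<Rightarrow> ('k, 'n) mpoly"
    (infixr \<open>\<odot>\<close> 75) where
  "f \<odot> g = (\<Sum>m\<in>Poly_Mapping.keys f. const_poly (poly_mapping.lookup f m) * monom_diff m g)"

lemma lookup_const_poly_mult:
  "poly_mapping.lookup (const_poly c * g) m = c * poly_mapping.lookup g m"
proof -
  have "const_poly c * g = Poly_Mapping.map ((*) c) g"
    by (simp add: const_poly_def mult_map_scale_conv_mult)
  then show ?thesis
    by (simp add: Poly_Mapping.map.rep_eq when_def)
qed

lemma lookup_pdiff:
  "poly_mapping.lookup (pdiff i g) e =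
     of_nat (poly_mapping.lookup e i + 1) * poly_mapping.lookup g (e + Poly_Mapping.single i 1)"
proof -
  let ?s = "Poly_Mapping.single i (1::nat)"
  let ?c = "\<lambda>m. of_nat (poly_mapping.lookup m i) * poly_mapping.lookup g m"
  have iff: "m - ?s = e \<longleftrightarrow> m = e + ?s" if "poly_mapping.lookup m i \<noteq> 0" for m
  proof
    assume "m - ?s = e"
    then have e: "e = m - ?s" by simp
    show "m = e + ?s"
      unfolding e using that
      by (intro poly_mapping_eqI) (auto simp: lookup_add lookup_minus lookup_single when_def)
  qed simp
  have "poly_mapping.lookup (pdiff i g) e =
      (\<Sum>m\<in>Poly_Mapping.keys g. if m - ?s = e then ?c m else 0)"
    by (simp add: pdiff_def lookup_sum lookup_single when_def)
  also have "\<dots> = (\<Sum>m\<in>Poly_Mapping.keys g. if m = e + ?s then ?c m else 0)"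
  proof (rule sum.cong)
    fix m
    show "(if m - ?s = e then ?c m else 0) = (if m = e + ?s then ?c m else 0)"
      using iff[of m] by (cases "poly_mapping.lookup m i = 0") auto
  qed simp
  also have "\<dots> = ?c (e + ?s)"
    by (simp add: in_keys_iff)
  finally show ?thesis
    by (simp add: lookup_add)
qed

lemma pdiff_add: "pdiff i (g + h) = pdiff i g + pdiff i h"
  by (rule poly_mapping_eqI) (simp add: lookup_pdiff lookup_add algebra_simps)

lemma pdiff_const_mult: "pdiff i (const_poly c * g) = const_poly c * pdiff i g"
  by (rule poly_mapping_eqI) (simp add: lookup_pdiff lookup_const_poly_mult mult.left_commute)

lemma pdiff_commute: "pdiff i (pdiff j g) = pdiff j (pdiff i g)"
  by (cases "i = j")
    (auto intro!: poly_mapping_eqI simp: lookup_pdiff lookup_add lookup_single when_def algebra_simps)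

lemma pdiff_power_commute: "pdiff i ((pdiff j ^^ k) g) = (pdiff j ^^ k) (pdiff i g)"
  by (induction k) (simp_all add: pdiff_commute[of i j])

lemma pdiff_power_power_commute:
  "(pdiff i ^^ l) ((pdiff j ^^ k) g) = (pdiff j ^^ k) ((pdiff i ^^ l) g)"
  by (induction l) (simp_all add: pdiff_power_commute)

lemma comp_fun_commute_pdiff: "comp_fun_commute (\<lambda>i. pdiff i ^^ e i)"
  by unfold_locales (auto simp: fun_eq_iff pdiff_power_power_commute)

lemma pdiff_power_add: "(pdiff i ^^ k) (g + h) = (pdiff i ^^ k) g + (pdiff i ^^ k) h"
  by (induction k) (simp_all add: pdiff_add)

lemma pdiff_power_const_mult: "(pdiff i ^^ k) (const_poly c * g) = const_poly c * (pdiff i ^^ k) g"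
  by (induction k) (simp_all add: pdiff_const_mult)

lemma monom_diff_add: "monom_diff m (g + h) = monom_diff m g + monom_diff m h"
proof -
  interpret comp_fun_commute "\<lambda>i. pdiff i ^^ poly_mapping.lookup m i"
    by (rule comp_fun_commute_pdiff)
  have "Finite_Set.fold (\<lambda>i. pdiff i ^^ poly_mapping.lookup m i) (g + h) A =
      Finite_Set.fold (\<lambda>i. pdiff i ^^ poly_mapping.lookup m i) g A +
      Finite_Set.fold (\<lambda>i. pdiff i ^^ poly_mapping.lookup m i) h A" if "finite A" for A
    using that by induction (simp_all add: pdiff_power_add)
  then show ?thesis by (simp add: monom_diff_def)
qed

lemma monom_diff_const_mult: "monom_diff m (const_poly c * g) = const_poly c * monom_diff m g"
proof -
  interpret comp_fun_commute "\<lambda>i. pdiff i ^^ poly_mapping.lookup m i"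
    by (rule comp_fun_commute_pdiff)
  have "Finite_Set.fold (\<lambda>i. pdiff i ^^ poly_mapping.lookup m i) (const_poly c * g) A =
      const_poly c * Finite_Set.fold (\<lambda>i. pdiff i ^^ poly_mapping.lookup m i) g A" if "finite A" for A
    using that by induction (simp_all add: pdiff_power_const_mult)
  then show ?thesis by (simp add: monom_diff_def)
qed

lemma monom_diff_zero_left:
  fixes g :: "('k::comm_ring_1, 'n::finite) mpoly"
  shows "monom_diff 0 g = g"
proof -
  have "Finite_Set.fold (\<lambda>i x. x) g A = g" if "finite A" for A :: "'n set"
  proof -
    interpret comp_fun_commute "\<lambda>(i::'n) (x::('k, 'n) mpoly). x"
      by unfold_locales auto
    show ?thesis
      using that by induction simp_all
  qed
  then show ?thesis by (simp add: monom_diff_def id_def)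
qed

lemma monom_diff_monom_diff:
  fixes g :: "('k::comm_ring_1, 'n::finite) mpoly"
  shows "monom_diff m (monom_diff m' g) = monom_diff (m + m') g"
proof -
  let ?f = "\<lambda>m i. (pdiff i :: ('k, 'n) mpoly \<Rightarrow> _) ^^ poly_mapping.lookup m i"
  interpret a: comp_fun_commute "?f m" by (rule comp_fun_commute_pdiff)
  interpret b: comp_fun_commute "?f m'" by (rule comp_fun_commute_pdiff)
  interpret c: comp_fun_commute "?f (m + m')" by (rule comp_fun_commute_pdiff)
  have shift: "Finite_Set.fold (?f m) ((pdiff j ^^ k) h) A = (pdiff j ^^ k) (Finite_Set.fold (?f m) h A)"
    if "finite A" for j k h and A :: "'n set"
    using that
  proof induction
    case (insert x A)
    then show ?case
      by (simp add: pdiff_power_power_commute[where i = j])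
  qed simp
  have "Finite_Set.fold (?f m) (Finite_Set.fold (?f m') g A) A = Finite_Set.fold (?f (m + m')) g A"
    if "finite A" for A
    using that
  proof induction
    case (insert x A)
    have "Finite_Set.fold (?f (m + m')) g (insert x A) =
        ?f m x (?f m' x (Finite_Set.fold (?f (m + m')) g A))"
      unfolding c.fold_insert[OF insert.hyps] by (simp add: lookup_add funpow_add)
    then show ?case
      unfolding a.fold_insert[OF insert.hyps] b.fold_insert[OF insert.hyps]
      by (simp only: shift[OF insert.hyps(1)] insert.IH)
  qed simp
  then show ?thesis by (simp add: monom_diff_def)
qed

lemma const_poly_add: "const_poly (a + b) = const_poly a + const_poly b"
  by (simp add: const_poly_def single_add)

lemma const_poly_mult: "const_poly (a * b) = const_poly a * const_poly b"
  by (simp add: const_poly_def mult_single)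

lemma diff_act_superset:
  assumes "finite A" "Poly_Mapping.keys f \<subseteq> A"
  shows "f \<odot> g = (\<Sum>m\<in>A. const_poly (poly_mapping.lookup f m) * monom_diff m g)"
  unfolding diff_act_def using assms
  by (intro sum.mono_neutral_left) (auto simp: in_keys_iff const_poly_def)

lemma diff_act_add_left: "(f + f') \<odot> g = f \<odot> g + f' \<odot> g"
proof -
  let ?A = "Poly_Mapping.keys f \<union> Poly_Mapping.keys f'"
  have "Poly_Mapping.keys (f + f') \<subseteq> ?A" by (rule keys_add)
  then show ?thesis
    by (simp add: diff_act_superset[where A = ?A] lookup_add const_poly_add
        distrib_right sum.distrib)
qed

lemma diff_act_add_right: "f \<odot> (g + h) = f \<odot> g + f \<odot> h"
  by (simp add: diff_act_def monom_diff_add distrib_left sum.distrib)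

lemma diff_act_zero_left: "0 \<odot> g = 0"
  by (simp add: diff_act_def)

lemma diff_act_single: "Poly_Mapping.single m c \<odot> g = const_poly c * monom_diff m g"
  by (simp add: diff_act_def const_poly_def)

lemma poly_mapping_add_induct [case_names zero single add]:
  fixes f :: "'a \<Rightarrow>\<^sub>0 'b::ab_group_add"
  assumes zero: "P 0" and single: "\<And>m c. P (Poly_Mapping.single m c)"
    and add: "\<And>f g. P f \<Longrightarrow> P g \<Longrightarrow> P (f + g)"
  shows "P f"
proof -
  have "P (\<Sum>m\<in>A. Poly_Mapping.single m (poly_mapping.lookup f m))" if "finite A" for A
    using that by induction (simp_all add: assms)
  moreover have "f = (\<Sum>m\<in>Poly_Mapping.keys f. Poly_Mapping.single m (poly_mapping.lookup f m))"
    by (rule poly_mapping_eqI) (simp add: lookup_sum lookup_single when_def in_keys_iff)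
  ultimately show ?thesis by (metis finite_keys)
qed

lemma diff_act_mult: "f \<odot> (f' \<odot> g) = (f * f') \<odot> g"
proof (induction f rule: poly_mapping_add_induct)
  case (single m c)
  show ?case
  proof (induction f' rule: poly_mapping_add_induct)
    case zero
    show ?case by (simp add: diff_act_def monom_diff_const_mult[of m 0 0, simplified const_poly_def, simplified])
  next
    case (single m' c')
    show ?case
      by (simp add: diff_act_single mult_single monom_diff_const_mult monom_diff_monom_diff
          const_poly_mult mult.assoc)
  next
    case (add p q)
    then show ?case
      by (simp add: diff_act_add_left diff_act_add_right distrib_left)
  qed
qed (simp_all add: diff_act_zero_left diff_act_add_left distrib_right)

lemma diff_act_one: "1 \<odot> g = g"
proof -
  have "1 \<odot> g = Poly_Mapping.single 0 1 \<odot> g" by simp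
  also have "\<dots> = g"
    by (simp only: diff_act_single monom_diff_zero_left) (simp add: const_poly_def)
  finally show ?thesis .
qed

lemma module_diff_act: "module (\<odot>)"
  by unfold_locales
    (simp_all add: diff_act_add_left diff_act_add_right diff_act_mult diff_act_one)

definition submodule_gen :: "('k::comm_ring_1, 'n::finite) mpoly set \<Rightarrow> ('k, 'n) mpoly set" where
  "submodule_gen S = module.span (\<odot>) S"

definition annihilator :: "('k::comm_ring_1, 'n::finite) mpoly set \<Rightarrow> ('k, 'n) mpoly set" where
  "annihilator W = {g. \<forall>G\<in>W. g \<odot> G = 0}"


section \<open>Ideals of sets of points in projective space\<close>

definition eval_poly :: "('k::comm_ring_1, 'n::finite) mpoly \<Rightarrow> 'k ^ 'n \<Rightarrow> 'k" where
  "eval_poly f a = (\<Sum>m\<in>Poly_Mapping.keys f.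
     poly_mapping.lookup f m * (\<Prod>i\<in>UNIV. (a $ i) ^ poly_mapping.lookup m i))"

definition homogeneous :: "nat \<Rightarrow> ('k::comm_ring_1, 'n::finite) mpoly \<Rightarrow> bool" where
  "homogeneous d f \<longleftrightarrow> (\<forall>m\<in>Poly_Mapping.keys f. (\<Sum>i\<in>UNIV. poly_mapping.lookup m i) = d)"

text \<open>A point of projective space is the set of all its homogeneous coordinate vectors.\<close>

definition proportional :: "(('k::field ^ 'n) \<times> ('k ^ 'n)) set" where
  "proportional = {(v, w). v \<noteq> 0 \<and> w \<noteq> 0 \<and> (\<exists>c. c \<noteq> 0 \<and> w = c *s v)}"

definition proj_space :: "('k::field ^ 'n) set set" where
  "proj_space = {v. v \<noteq> 0} // proportional"

lemma equiv_proportional: "equiv {v. v \<noteq> 0} (proportional :: (('k::field ^ 'n) \<times> _) set)"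
proof (rule equivI)
  show "refl_on {v. v \<noteq> 0} (proportional :: (('k ^ 'n) \<times> _) set)"
    by (auto simp: refl_on_def proportional_def intro!: exI[of _ 1])
  show "sym (proportional :: (('k ^ 'n) \<times> _) set)"
  proof (rule symI)
    fix v w :: "'k ^ 'n"
    assume "(v, w) \<in> proportional"
    then obtain c where "v \<noteq> 0" "w \<noteq> 0" "c \<noteq> 0" "w = c *s v"
      by (auto simp: proportional_def)
    then show "(w, v) \<in> proportional"
      by (auto simp: proportional_def vector_smult_assoc intro!: exI[of _ "inverse c"])
  qed
  show "trans (proportional :: (('k ^ 'n) \<times> _) set)"
    by (rule transI) (force simp: proportional_def vector_smult_assoc)
qed (auto simp: proportional_def)

definition vanishes_at :: "('k::field, 'n::finite) mpoly \<Rightarrow> ('k ^ 'n) set \<Rightarrow> bool" where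
  "vanishes_at f p \<longleftrightarrow> (\<forall>a\<in>p. eval_poly f a = 0)"

definition hyperplane :: "('k::field ^ 'n::finite) set set \<Rightarrow> bool" where
  "hyperplane H \<longleftrightarrow>
     (\<exists>l. l \<noteq> 0 \<and> homogeneous 1 l \<and> H = {p \<in> proj_space. vanishes_at l p})"

text \<open>\<open>module.span (*) S\<close> is the ideal generated by \<open>S\<close>, a commutative ring being a module
  over itself.\<close>

lemma module_times: "module ((*) :: 'a::comm_ring_1 \<Rightarrow> 'a \<Rightarrow> 'a)"
  by unfold_locales (simp_all add: algebra_simps)

definition homogeneous_ideal :: "('k::field ^ 'n::finite) set set \<Rightarrow> ('k, 'n) mpoly set" where
  "homogeneous_ideal X = module.span (*) {f. (\<exists>d. homogeneous d f) \<and> (\<forall>p\<in>X. vanishes_at f p)}"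

definition linear_form :: "'k::comm_ring_1 ^ 'n::finite \<Rightarrow> ('k, 'n) mpoly" where
  "linear_form a = (\<Sum>i\<in>UNIV. const_poly (a $ i) * var_poly i)"

end

theory Submission
  imports Defs
begin

text \<open>
  On the divided powers \<open>L\<^bsup>[m]\<^esup> = L\<^sup>m / m!\<close> of the linear form of \<open>a\<close>, a form \<open>f\<close> of degree
  \<open>d\<close> acts by \<open>f \<circ> L\<^bsup>[m]\<^esup> = f(a) L\<^bsup>[m - d]\<^esup>\<close>.  A product of linear forms vanishing at all points but
  \<open>P\<^sub>i\<close>, padded to degree \<open>r + u\<close>, therefore extracts a nonzero multiple of \<open>L\<^sub>i\<^sup>s\<close> from \<open>F\<^bsub>s+r\<^esub>\<close>, which
  gives (1).  For (2), \<open>f\<close> kills all powers of \<open>L\<^sub>i\<close> if and only if every homogeneous component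
  of \<open>f\<close> vanishes at \<open>a\<^sub>i\<close>: if the components of degree below \<open>m\<close> vanish there, then
  \<open>f \<circ> L\<^sub>i\<^bsup>[m]\<^esup>\<close> is the constant \<open>f\<^sub>m(a\<^sub>i)\<close>.
\<close>

section \<open>Derivatives of divided powers of linear forms\<close>

lemma const_poly_zero [simp]: "const_poly 0 = 0"
  by (simp add: const_poly_def)

lemma const_poly_one [simp]: "const_poly 1 = 1"
  by (simp add: const_poly_def)

lemma const_poly_eq_zero_iff [simp]: "const_poly c = 0 \<longleftrightarrow> c = 0"
  by (metis const_poly_def lookup_single_eq lookup_zero const_poly_zero)

lemma const_poly_mult_assoc: "const_poly a * (const_poly b * g) = const_poly (a * b) * g"
  by (simp add: const_poly_mult mult.assoc)

lemma const_poly_sum: "const_poly (sum f A) = (\<Sum>i\<in>A. const_poly (f i))"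
  by (induction A rule: infinite_finite_induct) (simp_all add: const_poly_add)

lemma pdiff_single:
  "pdiff i (Poly_Mapping.single m c) =
     Poly_Mapping.single (m - Poly_Mapping.single i 1) (of_nat (poly_mapping.lookup m i) * c)"
  by (cases "c = 0") (simp_all add: pdiff_def)

lemma pdiff_zero [simp]: "pdiff i 0 = 0"
  by (simp add: pdiff_def)

lemma pdiff_one [simp]: "pdiff i 1 = 0"
  using pdiff_single[of i 0 1] by simp

lemma pdiff_sum: "pdiff i (sum f A) = (\<Sum>x\<in>A. pdiff i (f x))"
  by (induction A rule: infinite_finite_induct) (simp_all add: pdiff_add)

lemma pdiff_mult: "pdiff i (g * h) = pdiff i g * h + g * pdiff i h"
proof (induction g rule: poly_mapping_add_induct)
  case (single m c)
  show ?case
  proof (induction h rule: poly_mapping_add_induct)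
    case (single m' c')
    let ?s = "Poly_Mapping.single i (Suc 0)"
    have shift: "Poly_Mapping.single (e + e' - ?s) (of_nat (poly_mapping.lookup e i) * x) =
        Poly_Mapping.single (e - ?s + e') (of_nat (poly_mapping.lookup e i) * x)" for e e' and x :: 'b
    proof (cases "poly_mapping.lookup e i = 0")
      case False
      then have "e + e' - ?s = e - ?s + e'"
        by (intro poly_mapping_eqI) (auto simp: lookup_add lookup_minus lookup_single when_def)
      then show ?thesis by simp
    qed simp
    show ?case
      using shift[of m m' "c * c'"] shift[of m' m "c * c'"]
      by (simp add: mult_single pdiff_single lookup_add distrib_right single_add mult.assoc
          mult.left_commute[of c] add.commute[of m' m] add.commute[of m "m' - ?s"])
  qed (simp_all add: pdiff_add distrib_left)
qed (simp_all add: pdiff_add distrib_right)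

lemma pdiff_linear_form:
  fixes a :: "'k::comm_ring_1 ^ 'n::finite"
  shows "pdiff i (linear_form a) = const_poly (a $ i)"
proof -
  have "pdiff i (var_poly j :: ('k, 'n) mpoly) = (if j = i then 1 else 0)" for j
    by (auto simp: var_poly_def pdiff_single lookup_single when_def)
  then have "pdiff i (linear_form a) = (\<Sum>j\<in>UNIV. if j = i then const_poly (a $ j) else 0)"
    unfolding linear_form_def pdiff_sum pdiff_const_mult by (intro sum.cong) simp_all
  then show ?thesis by simp
qed

lemma pdiff_linear_form_power:
  "pdiff i (linear_form a ^ Suc m) = const_poly (of_nat (Suc m) * a $ i) * linear_form a ^ m"
proof (induction m)
  case 0
  show ?case by (simp add: pdiff_linear_form)
next
  case (Suc m)
  have "pdiff i (linear_form a ^ Suc (Suc m)) =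
      const_poly (a $ i) * linear_form a ^ Suc m +
      linear_form a * (const_poly (of_nat (Suc m) * a $ i) * linear_form a ^ m)"
    by (simp only: power_Suc[of _ "Suc m"] pdiff_mult pdiff_linear_form Suc.IH)
  also have "\<dots> = (const_poly (a $ i) + const_poly (of_nat (Suc m) * a $ i)) * linear_form a ^ Suc m"
    by (simp add: algebra_simps)
  finally show ?case
    by (simp add: const_poly_add[symmetric] algebra_simps)
qed

definition div_power :: "'k::field_char_0 ^ 'n::finite \<Rightarrow> nat \<Rightarrow> ('k, 'n) mpoly" where
  "div_power a m = const_poly (1 / fact m) * linear_form a ^ m"

lemma div_power_0 [simp]: "div_power a 0 = 1"
  by (simp add: div_power_def)

lemma linear_form_power_eq: "linear_form a ^ m = const_poly (fact m) * div_power a m"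
  by (simp add: div_power_def const_poly_mult_assoc)

lemma pdiff_div_power_Suc: "pdiff i (div_power a (Suc m)) = const_poly (a $ i) * div_power a m"
proof -
  have "1 / fact (Suc m) * (of_nat (Suc m) * a $ i) = a $ i * (1 / fact m)"
    by (simp add: divide_simps del: of_nat_Suc)
  then show ?thesis
    unfolding div_power_def pdiff_const_mult pdiff_linear_form_power const_poly_mult_assoc
    by (simp only:)
qed

lemma pdiff_power_div_power:
  fixes a :: "'k::field_char_0 ^ 'n::finite"
  shows "(pdiff i ^^ k) (div_power a m) =
     (if k \<le> m then const_poly ((a $ i) ^ k) * div_power a (m - k) else 0)"
proof (induction k)
  case (Suc k)
  show ?case
  proof (cases "k < m")
    case True
    then have "m - k = Suc (m - Suc k)" by simp
    then show ?thesis
      using True Suc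
      by (simp add: pdiff_const_mult pdiff_div_power_Suc const_poly_mult_assoc mult.commute)
  next
    case False
    have "pdiff i (const_poly c :: ('k, 'n) mpoly) = 0" for c
      using pdiff_const_mult[of i c 1] by simp
    with False show ?thesis
      using Suc by (cases "k = m") simp_all
  qed
qed simp

definition exp_degree :: "('n::finite \<Rightarrow>\<^sub>0 nat) \<Rightarrow> nat" where
  "exp_degree m = (\<Sum>i\<in>UNIV. poly_mapping.lookup m i)"

definition eval_monom :: "('n::finite \<Rightarrow>\<^sub>0 nat) \<Rightarrow> 'k::comm_ring_1 ^ 'n \<Rightarrow> 'k" where
  "eval_monom m a = (\<Prod>i\<in>UNIV. (a $ i) ^ poly_mapping.lookup m i)"

lemma monom_diff_div_power:
  fixes a :: "'k::field_char_0 ^ 'n::finite"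
  shows "monom_diff e (div_power a m) =
     (if exp_degree e \<le> m then const_poly (eval_monom e a) * div_power a (m - exp_degree e) else 0)"
proof -
  let ?l = "poly_mapping.lookup e"
  interpret comp_fun_commute "\<lambda>i. (pdiff i :: ('k, 'n) mpoly \<Rightarrow> _) ^^ ?l i"
    by (rule comp_fun_commute_pdiff)
  have "Finite_Set.fold (\<lambda>i. pdiff i ^^ ?l i) (div_power a m) A =
      (if sum ?l A \<le> m then const_poly (\<Prod>i\<in>A. (a $ i) ^ ?l i) * div_power a (m - sum ?l A) else 0)"
    if "finite A" for A
    using that
  proof induction
    case (insert x A)
    have "(pdiff x ^^ k) (0 :: ('k, 'n) mpoly) = 0" for k
      by (induction k) simp_all
    then show ?case
      using insert
      by (auto simp: pdiff_power_const_mult pdiff_power_div_power const_poly_mult_assoc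
          mult.commute[of "\<Prod>i\<in>A. (a $ i) ^ ?l i"] add.commute)
  qed simp
  then show ?thesis
    by (simp add: monom_diff_def exp_degree_def eval_monom_def)
qed

section \<open>The action of forms on divided powers\<close>

lemma diff_act_const_mult: "f \<odot> (const_poly c * g) = const_poly c * (f \<odot> g)"
  by (simp add: diff_act_def monom_diff_const_mult sum_distrib_left mult.left_commute)

lemma const_poly_diff_act: "const_poly c \<odot> g = const_poly c * g"
  using diff_act_single[of 0 c g] by (simp add: const_poly_def[of c] monom_diff_zero_left)

lemma diff_act_commute: "f \<odot> (g \<odot> h) = g \<odot> (f \<odot> h)"
  by (simp add: diff_act_mult mult.commute)

lemma diff_act_zero_right [simp]: "f \<odot> 0 = 0"
  using diff_act_const_mult[of f 0 0] by simp

lemma diff_act_sum_right: "f \<odot> sum g A = (\<Sum>i\<in>A. f \<odot> g i)"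
  by (induction A rule: infinite_finite_induct) (simp_all add: diff_act_add_right)

lemma diff_act_sum_left: "sum f A \<odot> g = (\<Sum>i\<in>A. f i \<odot> g)"
  by (induction A rule: infinite_finite_induct) (simp_all add: diff_act_add_left diff_act_zero_left)

lemma homogeneous_diff_act_div_power:
  assumes "homogeneous d f"
  shows "f \<odot> div_power a m =
    (if d \<le> m then const_poly (eval_poly f a) * div_power a (m - d) else 0)"
proof -
  have "f \<odot> div_power a m = (\<Sum>e\<in>Poly_Mapping.keys f. if d \<le> m
      then const_poly (poly_mapping.lookup f e * eval_monom e a) * div_power a (m - d) else 0)"
    unfolding diff_act_def using assms
    by (intro sum.cong)
      (auto simp: homogeneous_def exp_degree_def monom_diff_div_power const_poly_mult_assoc)
  then show ?thesis
    by (simp add: eval_poly_def eval_monom_def const_poly_sum sum_distrib_right)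
qed

lemma linear_form_diff_act_div_power:
  "linear_form c \<odot> div_power a (Suc m) = const_poly (\<Sum>i\<in>UNIV. c $ i * a $ i) * div_power a m"
proof -
  have monom: "eval_monom (Poly_Mapping.single i 1) a = a $ i"
    "exp_degree (Poly_Mapping.single i 1) = 1" for i
  proof -
    have "eval_monom (Poly_Mapping.single i 1) a = (\<Prod>j\<in>UNIV. if j = i then a $ j else 1)"
      unfolding eval_monom_def by (intro prod.cong) (auto simp: lookup_single when_def)
    then show "eval_monom (Poly_Mapping.single i 1) a = a $ i" by simp
    show "exp_degree (Poly_Mapping.single i 1) = 1"
      by (simp add: exp_degree_def lookup_single when_def)
  qed
  have "(const_poly (c $ i) * var_poly i) \<odot> div_power a (Suc m) =
      const_poly (c $ i * a $ i) * div_power a m" for i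
    by (simp add: diff_act_mult[symmetric] const_poly_diff_act var_poly_def diff_act_single
        monom_diff_div_power monom const_poly_mult_assoc flip: One_nat_def)
  then show ?thesis
    by (simp add: linear_form_def diff_act_sum_left const_poly_sum sum_distrib_right)
qed

lemma prod_linear_form_diff_act_div_power:
  assumes "finite J"
  shows "(\<Prod>j\<in>J. linear_form (c j)) \<odot> div_power a (m + card J) =
    const_poly (\<Prod>j\<in>J. \<Sum>i\<in>UNIV. c j $ i * a $ i) * div_power a m"
  using assms
proof (induction arbitrary: m)
  case empty
  show ?case by (simp add: diff_act_one)
next
  case (insert j J)
  have "(\<Prod>j\<in>insert j J. linear_form (c j)) \<odot> div_power a (m + card (insert j J)) =
      linear_form (c j) \<odot> ((\<Prod>j\<in>J. linear_form (c j)) \<odot> div_power a (Suc m + card J))"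
    using insert.hyps by (simp add: diff_act_mult)
  then show ?case
    using insert.hyps
    by (simp add: insert.IH[of "Suc m"] diff_act_const_mult linear_form_diff_act_div_power const_poly_mult_assoc
        mult.commute[of "\<Sum>i\<in>UNIV. c j $ i * a $ i"] del: add_Suc)
qed

definition hom_component :: "nat \<Rightarrow> ('k::comm_ring_1, 'n::finite) mpoly \<Rightarrow> ('k, 'n) mpoly" where
  "hom_component d f =
     (\<Sum>m\<in>{m \<in> Poly_Mapping.keys f. exp_degree m = d}. Poly_Mapping.single m (poly_mapping.lookup f m))"

lemma lookup_hom_component:
  "poly_mapping.lookup (hom_component d f) m = (if exp_degree m = d then poly_mapping.lookup f m else 0)"
  by (simp add: hom_component_def lookup_sum lookup_single when_def in_keys_iff)

lemma homogeneous_hom_component: "homogeneous d (hom_component d f)"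
  by (auto simp: homogeneous_def in_keys_iff lookup_hom_component exp_degree_def split: if_splits)

lemma sum_hom_components: "f = (\<Sum>d\<in>exp_degree ` Poly_Mapping.keys f. hom_component d f)"
  by (rule poly_mapping_eqI) (auto simp: lookup_sum lookup_hom_component in_keys_iff)

lemma hom_component_eq_zero: "d \<notin> exp_degree ` Poly_Mapping.keys f \<Longrightarrow> hom_component d f = 0"
  by (intro poly_mapping_eqI) (auto simp: lookup_hom_component image_iff in_keys_iff)

lemma eval_hom_component_eq_zero:
  assumes "\<And>m. f \<odot> div_power a m = 0"
  shows "eval_poly (hom_component d f) a = 0"
proof (induction d rule: less_induct)
  case (less d)
  let ?D = "exp_degree ` Poly_Mapping.keys f"
  let ?c = "eval_poly (hom_component d f) a"
  have "0 = (\<Sum>e\<in>?D. hom_component e f) \<odot> div_power a d"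
    using assms[of d] sum_hom_components[of f] by simp
  also have "\<dots> = (\<Sum>e\<in>?D. if e = d then const_poly ?c else 0)"
    unfolding diff_act_sum_left
    by (intro sum.cong)
      (auto simp: homogeneous_diff_act_div_power[OF homogeneous_hom_component] less)
  also have "\<dots> = const_poly ?c"
    using hom_component_eq_zero[of d f] by (auto simp: eval_poly_def)
  finally show ?case by simp
qed

section \<open>Points of projective space\<close>

lemma eval_poly_scale:
  assumes "homogeneous d f"
  shows "eval_poly f (c *s a) = c ^ d * eval_poly f a"
  unfolding eval_poly_def sum_distrib_left using assms
  by (intro sum.cong refl)
    (auto simp: homogeneous_def power_mult_distrib prod.distrib power_sum[symmetric])

lemma proj_space_eq_class:
  assumes "p \<in> proj_space" "a \<in> p"
  shows "p = proportional `` {a}"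
  using assms unfolding proj_space_def
  by (metis (no_types, lifting) Image_singleton_iff equiv_class_eq equiv_proportional quotientE)

lemma proj_space_nonzero:
  assumes "p \<in> proj_space" "a \<in> p"
  shows "a \<noteq> 0"
  using assms by (auto simp: proj_space_def quotient_def proportional_def)

lemma vanishes_at_iff:
  assumes "p \<in> proj_space" "a \<in> p" "homogeneous d f"
  shows "vanishes_at f p \<longleftrightarrow> eval_poly f a = 0"
proof
  assume "eval_poly f a = 0"
  then have "eval_poly f b = 0" if "b \<in> p" for b
    using that eval_poly_scale[OF assms(3)] unfolding proj_space_eq_class[OF assms(1,2)]
    by (auto simp: proportional_def)
  then show "vanishes_at f p" by (simp add: vanishes_at_def)
qed (use assms in \<open>simp add: vanishes_at_def\<close>)

lemma nonvanishing_linear_form: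
  fixes a :: "'k::field ^ 'n::finite"
  assumes "a \<noteq> 0"
  obtains c where "(\<Sum>i\<in>UNIV. c $ i * a $ i) \<noteq> 0"
proof -
  obtain k where k: "a $ k \<noteq> 0"
    using assms by (auto simp: vec_eq_iff)
  have "(\<Sum>i\<in>UNIV. axis k 1 $ i * a $ i) = (\<Sum>i\<in>UNIV. if i = k then a $ i else 0)"
    by (intro sum.cong) (auto simp: axis_def)
  with k show thesis
    by (intro that[of "axis k 1"]) simp
qed

lemma separating_linear_form:
  fixes a b :: "'k::field ^ 'n::finite"
  assumes "p \<in> proj_space" "q \<in> proj_space" "a \<in> p" "b \<in> q" "p \<noteq> q"
  obtains c where "(\<Sum>i\<in>UNIV. c $ i * b $ i) = 0" "(\<Sum>i\<in>UNIV. c $ i * a $ i) \<noteq> 0"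
proof -
  have nz: "a \<noteq> 0" "b \<noteq> 0"
    using assms proj_space_nonzero by blast+
  then obtain k where k: "b $ k \<noteq> 0"
    by (auto simp: vec_eq_iff)
  define c :: "'n \<Rightarrow> 'k ^ 'n" where "c l = b $ k *s axis l 1 - b $ l *s axis k 1" for l
  have pairing: "(\<Sum>i\<in>UNIV. c l $ i * x $ i) = b $ k * x $ l - b $ l * x $ k" for l x
  proof -
    have "(\<Sum>i\<in>UNIV. c l $ i * x $ i) =
        (\<Sum>i\<in>UNIV. (if i = l then b $ k * x $ l else 0) - (if i = k then b $ l * x $ k else 0))"
      by (intro sum.cong) (auto simp: c_def axis_def algebra_simps)
    then show ?thesis by (simp add: sum_subtractf)
  qed
  have "\<exists>l. b $ k * a $ l \<noteq> b $ l * a $ k"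
  proof (rule ccontr)
    assume "\<nexists>l. b $ k * a $ l \<noteq> b $ l * a $ k"
    then have a: "a = (a $ k / b $ k) *s b"
      using k by (simp add: vec_eq_iff field_simps)
    then have "a $ k / b $ k \<noteq> 0"
      using nz by (metis vector_smult_lzero)
    with a nz have "(b, a) \<in> proportional"
      unfolding proportional_def by blast
    then have "a \<in> q"
      using proj_space_eq_class[OF assms(2,4)] by blast
    then show False
      using proj_space_eq_class assms by metis
  qed
  then obtain l where "b $ k * a $ l \<noteq> b $ l * a $ k" by blast
  with pairing[of l] show thesis
    by (intro that[of "c l"]) simp_all
qed

section \<open>Submodules and annihilators\<close>

lemma submodule_gen_scale: "g \<in> submodule_gen S \<Longrightarrow> f \<odot> g \<in> submodule_gen S"
  unfolding submodule_gen_def by (rule module.span_scale[OF module_diff_act])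

lemma submodule_gen_const_mult: "g \<in> submodule_gen S \<Longrightarrow> const_poly c * g \<in> submodule_gen S"
  using submodule_gen_scale[of g S "const_poly c"] by (simp add: const_poly_diff_act)

lemma submodule_gen_eqI:
  assumes "S \<subseteq> submodule_gen T" "T \<subseteq> submodule_gen S"
  shows "submodule_gen S = submodule_gen T"
  using assms unfolding submodule_gen_def
  by (simp add: module.span_eq[OF module_diff_act])

lemma annihilator_submodule_gen: "annihilator (submodule_gen S) = annihilator S"
proof
  show "annihilator S \<subseteq> annihilator (submodule_gen S)"
  proof
    fix f assume f: "f \<in> annihilator S"
    have "f \<odot> g = 0" if "g \<in> module.span (\<odot>) S" for g
      using that
    proof (induction rule: module.span_induct_alt[OF module_diff_act, consumes 1])
      case (2 c x y)
      then show ?case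
        using f by (simp add: diff_act_add_right diff_act_commute[of f] annihilator_def)
    qed simp
    then show "f \<in> annihilator (submodule_gen S)"
      by (simp add: annihilator_def submodule_gen_def)
  qed
  show "annihilator (submodule_gen S) \<subseteq> annihilator S"
    by (auto simp: annihilator_def submodule_gen_def module.span_base[OF module_diff_act])
qed

lemma ideal_span_subset_annihilator:
  assumes "S \<subseteq> annihilator W"
  shows "module.span (*) S \<subseteq> annihilator W"
proof
  fix f assume "f \<in> module.span (*) S"
  then show "f \<in> annihilator W"
  proof (induction rule: module.span_induct_alt[OF module_times, consumes 1])
    case 1
    show ?case by (simp add: annihilator_def diff_act_zero_left)
  next
    case (2 c x y)
    then show ?case
      using assms by (auto simp: annihilator_def diff_act_add_left diff_act_mult[symmetric])
  qed
qed

theorem proposition3p6: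
  fixes n r u :: nat
    and P :: "nat \<Rightarrow> ('k::{alg_closed_field, field_char_0} ^ 'n::finite) set"
    and a :: "nat \<Rightarrow> 'k ^ 'n"
    and \<alpha> :: "nat \<Rightarrow> 'k"
    and X :: "('k ^ 'n) set set"
    and L F :: "nat \<Rightarrow> ('k, 'n) mpoly"
    and M :: "('k, 'n) mpoly set"
  assumes n: "n \<ge> 1" "CARD('n) = n + 1"
    and points: "\<And>i. i \<in> {1..r} \<Longrightarrow> P i \<in> proj_space"
    and distinct: "inj_on P {1..r}"
    and X: "X = P ` {1..r}"
    and nondegenerate: "\<not> (\<exists>H. hyperplane H \<and> X \<subseteq> H)"
    and coordinates: "\<And>i. i \<in> {1..r} \<Longrightarrow> a i \<in> P i"
    and L: "\<And>i. i \<in> {1..r} \<Longrightarrow> L i = linear_form (a i)"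
    and u: "u \<ge> 1"
    and \<alpha>: "\<And>i. i \<in> {1..r} \<Longrightarrow> \<alpha> i \<noteq> 0"
    and F: "\<And>t. t \<ge> 1 \<Longrightarrow>
      F t = const_poly (1 / fact (t + u)) * (\<Sum>i = 1..r. const_poly (\<alpha> i) * L i ^ (t + u))"
    and M: "M = submodule_gen {F t | t. t \<ge> 1}"
  shows "M = submodule_gen {L i ^ t | i t. i \<in> {1..r} \<and> t \<ge> 1} \<and>
         homogeneous_ideal X = annihilator M"
proof
  have div: "const_poly (1 / fact m) * L i ^ m = div_power (a i) m" if "i \<in> {1..r}" for i m
    using L[OF that] by (simp add: div_power_def)
  have power_div: "L i ^ m = const_poly (fact m) * div_power (a i) m" if "i \<in> {1..r}" for i m
    using L[OF that] by (simp add: linear_form_power_eq)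
  have F_div: "F t = (\<Sum>i = 1..r. const_poly (\<alpha> i) * div_power (a i) (t + u))" if "t \<ge> 1" for t
    unfolding F[OF that] sum_distrib_left
    by (intro sum.cong refl) (simp add: mult.left_commute div)
  have nz: "a i \<noteq> 0" if "i \<in> {1..r}" for i
    using proj_space_nonzero[OF points coordinates] that by blast
  let ?pair = "\<lambda>c x :: 'k ^ 'n. \<Sum>l\<in>UNIV. c $ l * x $ l"
  let ?T = "{L i ^ t | i t. i \<in> {1..r} \<and> t \<ge> 1}"

  show M_eq: "M = submodule_gen ?T"
    unfolding M
  proof (rule submodule_gen_eqI)
    show "{F t | t. t \<ge> 1} \<subseteq> submodule_gen ?T"
    proof clarify
      fix t :: nat assume t: "1 \<le> t"
      have "L i ^ (t + u) \<in> submodule_gen ?T" if "i \<in> {1..r}" for i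
      proof -
        have "L i ^ (t + u) \<in> ?T"
          using that t by (metis (mono_tags, lifting) mem_Collect_eq trans_le_add1)
        then show ?thesis
          unfolding submodule_gen_def by (rule module.span_base[OF module_diff_act])
      qed
      then have "(\<Sum>i = 1..r. const_poly (\<alpha> i) * L i ^ (t + u)) \<in> submodule_gen ?T"
        by (metis (no_types, lifting) module.span_sum[OF module_diff_act] submodule_gen_const_mult submodule_gen_def)
      then show "F t \<in> submodule_gen ?T"
        unfolding F[OF t] by (rule submodule_gen_const_mult)
    qed
    show "?T \<subseteq> submodule_gen {F t | t. t \<ge> 1}"
    proof clarify
      fix i s assume i: "i \<in> {1..r}" and s: "1 \<le> (s::nat)"
      obtain c0 where c0: "?pair c0 (a i) \<noteq> 0"
        using nz[OF i] by (rule nonvanishing_linear_form)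
      have "\<exists>c. (j \<in> {1..r} - {i} \<longrightarrow> ?pair c (a j) = 0) \<and> ?pair c (a i) \<noteq> 0" for j
      proof (cases "j \<in> {1..r} - {i}")
        case True
        then have "P i \<noteq> P j"
          using distinct i by (auto dest: inj_onD)
        then obtain c where "?pair c (a j) = 0" "?pair c (a i) \<noteq> 0"
          using separating_linear_form[OF points points coordinates coordinates, of i j] i True
          by blast
        then show ?thesis by blast
      qed (use c0 in blast)
      then have "\<exists>c. \<forall>j. (j \<in> {1..r} - {i} \<longrightarrow> ?pair (c j) (a j) = 0) \<and> ?pair (c j) (a i) \<noteq> 0"
        by (rule choice[OF allI])
      then obtain c where c: "\<And>j. j \<in> {1..r} - {i} \<Longrightarrow> ?pair (c j) (a j) = 0"
          "\<And>j. ?pair (c j) (a i) \<noteq> 0"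
        by blast
      define p where "p = (\<Prod>j\<in>{1..r + u}. linear_form (c j))"
      define q where "q l = (\<Prod>j\<in>{1..r + u}. ?pair (c j) (a l))" for l
      have q: "q l = 0" if "l \<in> {1..r} - {i}" for l
        unfolding q_def using c(1)[OF that] that
        by (intro prod_zero) auto
      have qi: "q i \<noteq> 0"
        by (simp add: q_def c(2))
      have p: "p \<odot> div_power (a l) (s + (r + u)) = const_poly (q l) * div_power (a l) s" for l
        using prod_linear_form_diff_act_div_power[of "{1..r + u}" c "a l" s]
        by (simp add: p_def q_def)
      have "p \<odot> F (s + r) = (\<Sum>l = 1..r. const_poly (\<alpha> l * q l) * div_power (a l) s)"
        using s by (simp add: F_div diff_act_sum_right diff_act_const_mult add.assoc p const_poly_mult_assoc)
      also have "\<dots> = const_poly (\<alpha> i * q i) * div_power (a i) s"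
        using i q by (subst sum.remove[OF _ i]) auto
      finally have "L i ^ s = const_poly (fact s / (\<alpha> i * q i)) * (p \<odot> F (s + r))"
        using i \<alpha>[OF i] qi by (simp add: power_div const_poly_mult_assoc)
      moreover have "F (s + r) \<in> submodule_gen {F t | t. t \<ge> 1}"
        unfolding submodule_gen_def using s
        by (intro module.span_base[OF module_diff_act]) auto
      ultimately show "L i ^ s \<in> submodule_gen {F t | t. t \<ge> 1}"
        by (simp add: submodule_gen_scale submodule_gen_const_mult)
    qed
  qed

  have ann: "annihilator M = annihilator ?T"
    by (simp add: M_eq annihilator_submodule_gen)
  show "homogeneous_ideal X = annihilator M"
  proof
    show "homogeneous_ideal X \<subseteq> annihilator M"
      unfolding homogeneous_ideal_def ann
    proof (rule ideal_span_subset_annihilator, clarify)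
      fix f d assume hom: "homogeneous d f" and van: "\<forall>p\<in>X. vanishes_at f p"
      have "f \<odot> L i ^ t = 0" if i: "i \<in> {1..r}" for i t
      proof -
        have "eval_poly f (a i) = 0"
          using van vanishes_at_iff[OF points[OF i] coordinates[OF i] hom] i X by blast
        then show ?thesis
          by (simp add: power_div[OF i] diff_act_const_mult homogeneous_diff_act_div_power[OF hom])
      qed
      then show "f \<in> annihilator ?T"
        by (auto simp: annihilator_def)
    qed
    show "annihilator M \<subseteq> homogeneous_ideal X"
    proof
      fix f assume f: "f \<in> annihilator M"
      have kill: "f \<odot> div_power (a i) m = 0" if i: "i \<in> {1..r}" for i m
      proof -
        have pos: "f \<odot> div_power (a i) m = 0" if "m \<ge> 1" for m
        proof -
          have "f \<odot> L i ^ m = 0"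
            using f i that unfolding ann by (auto simp: annihilator_def)
          then show ?thesis
            using i by (simp add: div[symmetric] diff_act_const_mult)
        qed
        obtain c where c: "?pair c (a i) \<noteq> 0"
          using nz[OF i] by (rule nonvanishing_linear_form)
        have "const_poly (?pair c (a i)) * (f \<odot> 1) = linear_form c \<odot> (f \<odot> div_power (a i) 1)"
          using linear_form_diff_act_div_power[of c "a i" 0]
          by (simp add: diff_act_commute[of _ f] diff_act_const_mult[of f _ 1, simplified])
        also have "\<dots> = 0" by (simp add: pos)
        finally have "const_poly (1 / ?pair c (a i)) * (const_poly (?pair c (a i)) * (f \<odot> 1)) = 0"
          by simp
        then have "f \<odot> 1 = 0"
          using c by (simp add: const_poly_mult_assoc)
        with pos show ?thesis
          by (cases "m = 0") simp_all
      qed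
      have "hom_component d f \<in> homogeneous_ideal X" for d
      proof -
        have "vanishes_at (hom_component d f) (P i)" if i: "i \<in> {1..r}" for i
          using eval_hom_component_eq_zero[OF kill[OF i]]
            vanishes_at_iff[OF points[OF i] coordinates[OF i] homogeneous_hom_component]
          by blast
        then show ?thesis
          unfolding homogeneous_ideal_def X using homogeneous_hom_component
          by (intro module.span_base[OF module_times]) blast
      qed
      then have "(\<Sum>d\<in>exp_degree ` Poly_Mapping.keys f. hom_component d f) \<in> homogeneous_ideal X"
        unfolding homogeneous_ideal_def by (intro module.span_sum[OF module_times])
      then show "f \<in> homogeneous_ideal X"
        using sum_hom_components[of f] by simp
    qed
  qed
qed

end
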